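(* The function $H\mapsto\mathsf{V}(H,t)$, $H\in[0,1/2]$, behaves as follows: for every $0<t\le\tau_{1/2}$, $\mathsf{V}(H,t)$ strictly decreases in $H\in[0,1/2]$; and for every $t>\tau_{1/2}$ there exists a unique point $\widehat{H}_t\in(0,1/2)$ such that $\mathsf{V}(H,t)$ decreases for $H\in[0,\widehat{H}_t]$ and increases for $H\in(\widehat{H}_t,1/2]$.
   Context: For $H\in(0,1)$, $B^H=\{B^H_t, t\ge 0\}$ is a fractional Brownian motion with Hurst index $H$: a zero-mean Gaussian process (with continuous paths) with covariance $\mathsf{E}B^H_tB^H_s=\frac12(t^{2H}+s^{2H}-|t-s|^{2H})$. Define $X^H_t=\int_0^t e^s\,dB^H_s = e^tB^H_t-\int_0^t e^sB^H_s\,ds$, $t\ge 0$, and $\mathsf{V}(H,t)=\mathsf{E}(X^H_t)^2$. For $H=0$ the process is extended (as a limit of covariances as $H\downarrow0$) so that $\mathsf{V}(0,t)=\frac{e^{2t}+1}{2}$ for $t>0$. The number $\tau_{1/2}>1$ denotes the unique $t>0$ at which $\frac{\partial \mathsf{V}}{\partial H}(1/2,t)=0$; this derivative is negative for $0<t<\tau_{1/2}$ and positive for $t>\tau_{1/2}$. *)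

theory Defs
  imports "HOL-Probability.Probability"
begin

text \<open>Constant random variables count as (degenerate) Gaussian; this is needed for
  \<open>B\<^sub>0 = 0\<close> and for vanishing linear combinations.\<close>

definition gaussian_rv :: "'a measure \<Rightarrow> ('a \<Rightarrow> real) \<Rightarrow> bool" where
  "gaussian_rv M Y \<longleftrightarrow> Y \<in> borel_measurable M \<and>
     ((\<exists>\<mu>. AE \<omega> in M. Y \<omega> = \<mu>) \<or>
      (\<exists>\<mu> \<sigma>. \<sigma> > 0 \<and> distributed M lborel Y (\<lambda>x. ennreal (normal_density \<mu> \<sigma> x))))"

definition gaussian_process :: "'a measure \<Rightarrow> real set \<Rightarrow> (real \<Rightarrow> 'a \<Rightarrow> real) \<Rightarrow> bool" where
  "gaussian_process M I Y \<longleftrightarrow>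
     (\<forall>T a. finite T \<and> T \<subseteq> I \<longrightarrow> gaussian_rv M (\<lambda>\<omega>. \<Sum>t\<in>T. a t * Y t \<omega>))"

locale fractional_brownian_motion = prob_space M
  for M :: "'a measure" and H :: real and B :: "real \<Rightarrow> 'a \<Rightarrow> real" +
  assumes Hurst_index: "0 < H" "H < 1"
    and gaussian: "gaussian_process M {0..} B"
    and mean_zero: "t \<ge> 0 \<Longrightarrow> expectation (B t) = 0"
    and covariance: "s \<ge> 0 \<Longrightarrow> t \<ge> 0 \<Longrightarrow>
      expectation (\<lambda>\<omega>. B t \<omega> * B s \<omega>) =
        (t powr (2 * H) + s powr (2 * H) - \<bar>t - s\<bar> powr (2 * H)) / 2"
    and continuous_paths: "\<omega> \<in> space M \<Longrightarrow> continuous_on {0..} (\<lambda>t. B t \<omega>)"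

text \<open>The pathwise integral \<open>\<integral>\<^sub>0\<^sup>t e\<^sup>s dB\<^sub>s\<close>, defined through integration by parts.\<close>

definition exp_integral :: "(real \<Rightarrow> 'a \<Rightarrow> real) \<Rightarrow> real \<Rightarrow> 'a \<Rightarrow> real" where
  "exp_integral B t \<omega> = exp t * B t \<omega> - (LBINT s:{0..t}. exp s * B s \<omega>)"

text \<open>In the following, \<open>B H\<close> is a process on the probability space \<open>M H\<close>, for each Hurst index \<open>H\<close>.
  There is no process with continuous paths for \<open>H = 0\<close>; the value there (relevant for \<open>t > 0\<close>) is
  the limit of the second moments as \<open>H \<down> 0\<close>.\<close>

definition V :: "(real \<Rightarrow> 'a measure) \<Rightarrow> (real \<Rightarrow> real \<Rightarrow> 'a \<Rightarrow> real) \<Rightarrow> real \<Rightarrow> real \<Rightarrow> real" where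
  "V M B H t =
     (if H = 0 then (exp (2 * t) + 1) / 2
      else prob_space.expectation (M H) (\<lambda>\<omega>. (exp_integral (B H) t \<omega>)\<^sup>2))"

definition tau_half :: "(real \<Rightarrow> 'a measure) \<Rightarrow> (real \<Rightarrow> real \<Rightarrow> 'a \<Rightarrow> real) \<Rightarrow> real" where
  "tau_half M B =
     (THE t. t > 0 \<and> ((\<lambda>H. V M B H t) has_real_derivative 0) (at (1/2)))"

end

theory Submission
  imports Defs "HOL-Real_Asymp.Real_Asymp"
begin

text \<open>Write \<open>p = 2 H\<close>. Everything follows from the closed form
  \<open>V(H, t) = e\<^sup>t (t\<^sup>p + \<integral>\<^sub>0\<^sup>t x\<^sup>p sinh (t - x) dx)\<close>,
  that is, \<open>e\<^sup>t\<close> times the \<open>p\<close>-th moment of the positive measure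
  \<open>\<mu>\<^sub>t = \<delta>\<^sub>t + sinh (t - x) dx\<close> on \<open>(0, t]\<close>. The formula also holds at \<open>H = 0\<close>, where the total mass
  of \<open>\<mu>\<^sub>t\<close> is \<open>cosh t\<close>.

  The closed form comes from Fubini's theorem applied to \<open>e\<^sup>t B\<^sub>t - \<integral>\<^sub>0\<^sup>t e\<^sup>s B\<^sub>s ds\<close>
  (\<open>expectation_square_B_minus_J\<close>), which turns the second moment into a double integral of the
  covariance; this is then evaluated by an explicit antiderivative (\<open>second_moment_identity\<close>).

  The moments of \<open>\<mu>\<^sub>t\<close> are strictly convex in \<open>p\<close>: the derivative of \<open>p \<mapsto> x\<^sup>p\<close> is
  \<open>x\<^sup>p ln x\<close>, which strictly increases in \<open>p\<close> unless \<open>x = 1\<close>. In addition, the first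
  moment of \<open>\<mu>\<^sub>t\<close> is \<open>sinh t\<close>, which is less than \<open>cosh t\<close>, so that \<open>V(1/2, t) < V(0, t)\<close>. A strictly convex
  function on an interval whose right end value is below the left one either decreases throughout,
  namely if its slope at the right end is at most \<open>0\<close>, or it has an interior minimum, before which it decreases and
  after which it increases (\<open>strictly_convex_monotonicity\<close>).

  It remains to know the sign of the slope at \<open>H = 1/2\<close>, which is \<open>2 e\<^sup>t D(t)\<close> with
  \<open>D(t) = t ln t + \<integral>\<^sub>0\<^sup>t x ln x sinh (t - x) dx\<close>. The bounds
  \<open>x - 1 \<le> x ln x \<le> x\<^sup>2 - x\<close> show \<open>D < 0\<close> on \<open>(0, 1]\<close> and \<open>D(e) > 0\<close>, while
  \<open>D(t) / sinh (t - 1)\<close> is strictly increasing for \<open>t > 1\<close>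
  (\<open>slope_half_quotient_strict_mono\<close>). Hence \<open>D\<close> has exactly one zero, where it changes sign from
  negative to positive, and this zero is \<open>\<tau>\<^bsub>1/2\<^esub>\<close>.\<close>

section \<open>Integration on an interval\<close>

lemma has_real_derivative_integral:
  fixes g :: "real \<Rightarrow> real"
  assumes "continuous_on {0..} g" "0 < t"
  shows "((\<lambda>x. integral {0..x} g) has_real_derivative g t) (at t)"
proof -
  have "((\<lambda>x. integral {0..x} g) has_real_derivative g t) (at t within {0..t + 1})"
    using assms by (intro integral_has_real_derivative continuous_on_subset[OF assms(1)]) auto
  then show ?thesis
    using assms by (simp add: at_within_Icc_at)
qed

lemma integral_FTC_real:
  fixes f F :: "real \<Rightarrow> real"
  assumes "a \<le> b" "continuous_on {a..b} F"
    and "\<And>x. a < x \<Longrightarrow> x < b \<Longrightarrow> (F has_real_derivative f x) (at x)"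
  shows "integral {a..b} f = F b - F a"
  using assms
  by (intro integral_unique fundamental_theorem_of_calculus_interior)
     (auto simp: has_real_derivative_iff_has_vector_derivative)

section \<open>Power moments of a finite measure on a bounded interval\<close>

text \<open>The dominating constant for \<open>x powr r * ln x\<close>, uniform for \<open>x\<close> in \<open>(0, c]\<close> and
  \<open>r\<close> in \<open>[a, b]\<close>. Near \<open>0\<close> the logarithm is absorbed by \<open>- ln x \<le> x powr (- a) / a\<close>, and
  above \<open>1\<close> by \<open>ln x \<le> x\<close>.\<close>

lemma abs_powr_ln_le:
  fixes a b c r x :: real
  assumes "0 < a" "a \<le> r" "r \<le> b" "0 < x" "x \<le> c"
  shows "\<bar>x powr r * ln x\<bar> \<le> 1 / a + max 1 c powr (b + 1)"
proof (cases "x \<le> 1")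
  case True
  have "a * ln (1 / x) = ln ((1 / x) powr a)"
    using assms by (simp add: ln_powr)
  also have "\<dots> \<le> (1 / x) powr a"
    using assms by (intro order.trans[OF ln_le_minus_one]) (auto simp: powr_gt_zero)
  also have "\<dots> = x powr (- a)"
    using assms by (simp add: powr_minus_divide powr_divide)
  finally have "- ln x \<le> x powr (- a) / a"
    using assms by (simp add: ln_div field_simps)
  moreover have "x powr r \<le> x powr a"
    using assms True by (intro powr_mono') auto
  ultimately have "x powr r * (- ln x) \<le> x powr a * (x powr (- a) / a)"
    using assms True by (intro mult_mono) auto
  also have "\<dots> = 1 / a"
    using assms by (simp add: powr_add[symmetric])
  finally have "\<bar>x powr r * ln x\<bar> \<le> 1 / a"
    using True assms by (simp add: abs_mult ln_le_zero_iff)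
  also have "\<dots> \<le> 1 / a + max 1 c powr (b + 1)" by simp
  finally show ?thesis .
next
  case False
  have "x powr r * ln x \<le> x powr b * x powr 1"
    using False assms by (intro mult_mono powr_mono) (auto intro: order.trans[OF ln_le_minus_one])
  also have "\<dots> = x powr (b + 1)" by (simp add: powr_add)
  also have "\<dots> \<le> max 1 c powr (b + 1)"
    using assms by (intro powr_mono2) auto
  also have "\<dots> \<le> 1 / a + max 1 c powr (b + 1)" using assms by simp
  finally show ?thesis
    using False assms by (simp add: abs_mult)
qed

locale finite_bounded_law = finite_measure N for N :: "real measure" and c :: real +
  assumes sets_N [measurable_cong, simp]: "sets N = sets borel"
    and AE_support: "AE x in N. 0 < x \<and> x \<le> c"
begin

lemma integrable_powr:
  assumes "0 \<le> p"
  shows "integrable N (\<lambda>x. x powr p)"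
proof (rule integrable_const_bound[where B = "max 1 c powr p"])
  show "AE x in N. norm (x powr p) \<le> max 1 c powr p"
    using AE_support by eventually_elim (use assms in \<open>auto intro!: powr_mono2\<close>)
qed measurable

lemma integrable_powr_ln:
  assumes "0 < p"
  shows "integrable N (\<lambda>x. x powr p * ln x)"
proof (rule integrable_const_bound[where B = "1 / p + max 1 c powr (p + 1)"])
  show "AE x in N. norm (x powr p * ln x) \<le> 1 / p + max 1 c powr (p + 1)"
    using AE_support by eventually_elim (use assms in \<open>auto intro!: abs_powr_ln_le\<close>)
qed measurable

lemma continuous_on_moment: "continuous_on {0..b} (\<lambda>p. \<integral>x. x powr p \<partial>N)"
  unfolding continuous_on_sequentially comp_def
proof safe
  fix X :: "nat \<Rightarrow> real" and p
  assume p: "p \<in> {0..b}" and X: "\<forall>n. X n \<in> {0..b}" "X \<longlonglongrightarrow> p"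
  show "(\<lambda>n. \<integral>x. x powr X n \<partial>N) \<longlonglongrightarrow> (\<integral>x. x powr p \<partial>N)"
  proof (rule integral_dominated_convergence[where w = "\<lambda>_. max 1 c powr b"])
    show "AE x in N. (\<lambda>n. x powr X n) \<longlonglongrightarrow> x powr p"
      using AE_support by eventually_elim (auto intro!: tendsto_intros X)
    show "AE x in N. norm (x powr X n) \<le> max 1 c powr b" for n
      using AE_support
    proof eventually_elim
      case (elim x)
      have "x powr X n \<le> max 1 c powr X n" using elim X by (intro powr_mono2) auto
      also have "\<dots> \<le> max 1 c powr b" using X by (intro powr_mono) auto
      finally show ?case by simp
    qed
  qed auto
qed

text \<open>Differentiation under the integral sign by dominated convergence. The mean value theorem bounds the difference
  quotients of \<open>q \<mapsto> x powr q\<close> by the constant of \<open>abs_powr_ln_le\<close> as soon as \<open>q\<close> stays in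
  \<open>(p / 2, 2 p)\<close>, away from exponent \<open>0\<close>.\<close>

lemma has_real_derivative_moment:
  assumes p: "0 < p"
  shows "((\<lambda>p. \<integral>x. x powr p \<partial>N) has_real_derivative (\<integral>x. x powr p * ln x \<partial>N)) (at p)"
proof -
  let ?I = "{p / 2<..<2 * p}" and ?K = "1 / (p / 2) + max 1 c powr (2 * p + 1)"
  have *: "(\<lambda>n. ((\<integral>x. x powr X n \<partial>N) - (\<integral>x. x powr p \<partial>N)) / (X n - p))
      \<longlonglongrightarrow> (\<integral>x. x powr p * ln x \<partial>N)"
    if X: "\<forall>n. X n \<in> ?I - {p}" "X \<longlonglongrightarrow> p" for X
  proof -
    have nn: "0 \<le> X n" for n using X(1)[rule_format, of n] p by auto
    have "(\<lambda>n. \<integral>x. (x powr X n - x powr p) / (X n - p) \<partial>N) \<longlonglongrightarrow> (\<integral>x. x powr p * ln x \<partial>N)"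
    proof (rule integral_dominated_convergence[where w = "\<lambda>_. ?K"])
      show "AE x in N. (\<lambda>n. (x powr X n - x powr p) / (X n - p)) \<longlonglongrightarrow> x powr p * ln x"
        using AE_support
      proof eventually_elim
        case (elim x)
        then have "((\<lambda>q. x powr q) has_real_derivative x powr p * ln x) (at p)"
          by (auto intro!: derivative_eq_intros)
        then have "((\<lambda>q. (x powr q - x powr p) / (q - p)) \<longlongrightarrow> x powr p * ln x) (at p)"
          by (simp add: has_field_derivative_iff)
        then show ?case
          using X unfolding tendsto_at_iff_sequentially comp_def by auto
      qed
      show "AE x in N. norm ((x powr X n - x powr p) / (X n - p)) \<le> ?K" for n
        using AE_support
      proof eventually_elim
        case (elim x)
        have "norm (x powr X n - x powr p) \<le> ?K * norm (X n - p)"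
        proof (rule field_differentiable_bound[where S = ?I and f' = "\<lambda>q. x powr q * ln x"])
          show "((\<lambda>q. x powr q) has_field_derivative x powr q * ln x) (at q within ?I)" for q
            using elim by - (rule has_field_derivative_at_within, auto intro!: derivative_eq_intros)
          show "norm (x powr q * ln x) \<le> ?K" if "q \<in> ?I" for q
            unfolding real_norm_def using that elim p by (intro abs_powr_ln_le) auto
        qed (use X p in auto)
        then show ?case
          using X(1)[rule_format, of n] by (simp add: divide_le_eq)
      qed
    qed auto
    moreover have "(\<integral>x. (x powr X n - x powr p) / (X n - p) \<partial>N)
        = ((\<integral>x. x powr X n \<partial>N) - (\<integral>x. x powr p \<partial>N)) / (X n - p)" for n
      using nn p by (simp add: integrable_powr del: divide_cancel_right)
    ultimately show ?thesis by (simp only:)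
  qed
  have "((\<lambda>p. \<integral>x. x powr p \<partial>N) has_real_derivative (\<integral>x. x powr p * ln x \<partial>N)) (at p within ?I)"
    unfolding has_field_derivative_iff tendsto_at_iff_sequentially comp_def using * by blast
  moreover have "at p within ?I = at p"
    using p by (intro at_within_open) auto
  ultimately show ?thesis by simp
qed

text \<open>This is the strict convexity of the moments in the exponent: for \<open>x < 1\<close> the power decreases in the exponent, but it
  multiplies the negative number \<open>ln x\<close>; for \<open>x > 1\<close> the power increases and \<open>ln x\<close> is positive.\<close>

lemma log_moment_strict_mono:
  assumes "0 < p" "p < q" and "AE x in N. x \<noteq> 1" and "emeasure N (space N) \<noteq> 0"
  shows "(\<integral>x. x powr p * ln x \<partial>N) < (\<integral>x. x powr q * ln x \<partial>N)"
proof (rule integral_less_AE_space)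
  show "AE x in N. x powr p * ln x < x powr q * ln x"
    using AE_support assms(3)
  proof eventually_elim
    case (elim x)
    show ?case
    proof (cases "x < 1")
      case True
      then have "x powr q < x powr p" using elim assms by (intro powr_less_mono') auto
      with True elim show ?thesis by simp
    next
      case False
      with elim assms show ?thesis by (simp add: powr_less_mono)
    qed
  qed
qed (use assms in \<open>auto intro!: integrable_powr_ln\<close>)

end

text \<open>Both the path integral (weight \<open>exp\<close>) and the closed form of the second moment (weight
  \<open>sinh (t - x)\<close>) are integrals against such measures. The point \<open>0\<close> is left out so that
  \<open>x powr p\<close> and \<open>ln x\<close> are well behaved almost everywhere.\<close>

definition weighted_law :: "(real \<Rightarrow> real) \<Rightarrow> real \<Rightarrow> real measure" where
  "weighted_law w t = density lborel (\<lambda>x. ennreal (indicator {0<..t} x * w x))"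

context
  fixes w :: "real \<Rightarrow> real" and t :: real
  assumes w [measurable]: "w \<in> borel_measurable borel"
    and cont_w: "continuous_on {0..t} w"
    and nonneg_w: "\<And>x. x \<in> {0..t} \<Longrightarrow> 0 \<le> w x"
begin

lemma finite_bounded_weighted_law: "finite_bounded_law (weighted_law w t) t"
proof (intro finite_bounded_law.intro finite_measureI finite_bounded_law_axioms.intro)
  have "set_integrable lborel {0<..t} w"
    by (rule set_integrable_subset[OF borel_integrable_atLeastAtMost'[OF cont_w]]) auto
  then have "(\<integral>\<^sup>+x. ennreal (norm (indicator {0<..t} x * w x)) \<partial>lborel) < \<infinity>"
    by (simp add: set_integrable_def integrable_iff_bounded)
  moreover have "norm (indicator {0<..t} x * w x) = indicator {0<..t} x * w x" for x
    using nonneg_w by (auto simp: indicator_def)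
  ultimately show "emeasure (weighted_law w t) (space (weighted_law w t)) \<noteq> \<infinity>"
    by (simp add: weighted_law_def emeasure_density)
  show "sets (weighted_law w t) = sets borel" by (simp add: weighted_law_def)
  show "AE x in weighted_law w t. 0 < x \<and> x \<le> t"
    unfolding weighted_law_def by (subst AE_density) (auto simp: indicator_def)
qed

lemma integral_weighted_law:
  fixes f :: "real \<Rightarrow> real"
  assumes [measurable]: "f \<in> borel_measurable borel" and "continuous_on {0..t} (\<lambda>x. w x * f x)"
  shows "(\<integral>x. f x \<partial>weighted_law w t) = integral {0..t} (\<lambda>x. w x * f x)"
proof -
  have "(\<integral>x. f x \<partial>weighted_law w t) = (\<integral>x. (indicator {0<..t} x * w x) *\<^sub>R f x \<partial>lborel)"
    unfolding weighted_law_def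
    by (rule integral_density) (use nonneg_w in \<open>auto simp: indicator_def\<close>)
  also have "\<dots> = (\<integral>x. indicator {0..t} x *\<^sub>R (w x * f x) \<partial>lborel)"
  proof (rule integral_cong_AE)
    show "AE x in lborel. (indicator {0<..t} x * w x) *\<^sub>R f x = indicator {0..t} x *\<^sub>R (w x * f x)"
      using AE_lborel_singleton[of "0::real"] by eventually_elim (auto simp: indicator_def)
  qed measurable
  also have "\<dots> = integral {0..t} (\<lambda>x. w x * f x)"
    using set_borel_integral_eq_integral(2)[OF borel_integrable_atLeastAtMost'[OF assms(2)]]
    by (simp add: set_lebesgue_integral_def)
  finally show ?thesis .
qed

end

section \<open>The second moment of a path integral of fractional Brownian motion\<close>

lemma abs_mult_le_sum_squares: "\<bar>a * b\<bar> \<le> a\<^sup>2 + b\<^sup>2" for a b :: real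
proof -
  have "2 * (\<bar>a\<bar> * \<bar>b\<bar>) \<le> a\<^sup>2 + b\<^sup>2" using sum_squares_bound[of "\<bar>a\<bar>" "\<bar>b\<bar>"] by simp
  moreover have "0 \<le> \<bar>a\<bar> * \<bar>b\<bar>" by simp
  ultimately show ?thesis unfolding abs_mult by linarith
qed

text \<open>Cauchy-Schwarz against the constant function, obtained from \<open>0 \<le> \<integral> (m f - \<integral> f)\<^sup>2\<close>,
  where \<open>m\<close> is the total mass.\<close>

lemma (in finite_measure) square_integral_le:
  fixes f :: "'a \<Rightarrow> real"
  assumes [measurable]: "f \<in> borel_measurable M" and f2: "integrable M (\<lambda>x. (f x)\<^sup>2)"
  shows "(integral\<^sup>L M f)\<^sup>2 \<le> measure M (space M) * (\<integral>x. (f x)\<^sup>2 \<partial>M)"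
proof -
  let ?m = "measure M (space M)" and ?J = "integral\<^sup>L M f" and ?S = "\<integral>x. (f x)\<^sup>2 \<partial>M"
  have f: "integrable M f"
  proof (rule Bochner_Integration.integrable_bound)
    show "integrable M (\<lambda>x. 1 + (f x)\<^sup>2)" using f2 by simp
    show "AE x in M. norm (f x) \<le> norm (1 + (f x)\<^sup>2)"
      using abs_mult_le_sum_squares[of 1] by (auto simp: abs_of_nonneg add_nonneg_nonneg)
  qed measurable
  have "0 \<le> (\<integral>x. (?m * f x - ?J)\<^sup>2 \<partial>M)" by simp
  also have "\<dots> = (\<integral>x. ?m\<^sup>2 * (f x)\<^sup>2 - 2 * ?m * ?J * f x + ?J\<^sup>2 \<partial>M)"
    by (simp add: power2_eq_square algebra_simps)
  also have "\<dots> = ?m\<^sup>2 * ?S - 2 * ?m * ?J * ?J + ?m * ?J\<^sup>2"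
    using f f2 by simp
  also have "\<dots> = ?m * (?m * ?S - ?J\<^sup>2)"
    by (simp add: power2_eq_square algebra_simps)
  finally have *: "0 \<le> ?m * (?m * ?S - ?J\<^sup>2)" .
  show ?thesis
  proof (cases "?m = 0")
    case True
    then have "AE x in M. f x = 0"
      by (intro AE_I[of _ _ "space M"]) (auto simp: emeasure_eq_measure)
    then have "?J = 0" by (simp add: integral_eq_zero_AE)
    with True show ?thesis by simp
  next
    case False
    then have "0 < ?m" by (simp add: zero_less_measure_iff)
    with * show ?thesis by (simp add: zero_le_mult_iff)
  qed
qed

definition fbm_cov :: "real \<Rightarrow> real \<Rightarrow> real \<Rightarrow> real" where
  "fbm_cov p s u = (u powr p + s powr p - \<bar>u - s\<bar> powr p) / 2"

context fractional_brownian_motion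
begin

lemma expectation_product:
  "0 \<le> s \<Longrightarrow> 0 \<le> u \<Longrightarrow> expectation (\<lambda>\<omega>. B u \<omega> * B s \<omega>) = fbm_cov (2 * H) s u"
  by (simp add: fbm_cov_def covariance)

lemma measurable_B: "0 \<le> t \<Longrightarrow> B t \<in> borel_measurable M"
  using gaussian[unfolded gaussian_process_def, rule_format, of "{t}" "\<lambda>_. 1"]
  by (simp add: gaussian_rv_def)

text \<open>The Bochner integral of a non-integrable function is \<open>0\<close>, but the prescribed variance is positive.\<close>

lemma integrable_square_B:
  assumes "0 < t"
  shows "integrable M (\<lambda>\<omega>. (B t \<omega>)\<^sup>2)"
proof (rule ccontr)
  assume "\<not> ?thesis"
  then have "expectation (\<lambda>\<omega>. (B t \<omega>)\<^sup>2) = 0" by (rule not_integrable_integral_eq)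
  with covariance[of t t] assms show False by (simp add: power2_eq_square)
qed

lemma expectation_square_B: "0 < t \<Longrightarrow> expectation (\<lambda>\<omega>. (B t \<omega>)\<^sup>2) = t powr (2 * H)"
  using covariance[of t t] by (simp add: power2_eq_square)

text \<open>Continuity of the paths makes the process the pointwise limit of its values at the grid points below \<open>s\<close>. These
  approximations are jointly measurable since they take countably many random variables as values.
  The truncation \<open>max 0 s\<close> extends the process to the whole line.\<close>

lemma measurable_B_pair: "(\<lambda>(s, \<omega>). B (max 0 s) \<omega>) \<in> borel_measurable (borel \<Otimes>\<^sub>M M)"
proof (rule borel_measurable_LIMSEQ_real)
  let ?g = "\<lambda>n (s::real). real_of_int \<lfloor>s * real (Suc n)\<rfloor> / real (Suc n)"
  show "(\<lambda>z :: real \<times> 'a. B (max 0 (?g n (fst z))) (snd z)) \<in> borel_measurable (borel \<Otimes>\<^sub>M M)" for n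
  proof (rule measurable_compose_countable[where g = "\<lambda>z. \<lfloor>fst z * real (Suc n)\<rfloor>"])
    show "(\<lambda>z. B (max 0 (real_of_int i / real (Suc n))) (snd z)) \<in> borel_measurable (borel \<Otimes>\<^sub>M M)" for i
      by (rule measurable_compose[OF measurable_snd measurable_B]) simp
  qed measurable
  fix z :: "real \<times> 'a" assume "z \<in> space (borel \<Otimes>\<^sub>M M)"
  then have \<omega>: "snd z \<in> space M" by (auto simp: space_pair_measure)
  have "(\<lambda>n. ?g n (fst z)) \<longlonglongrightarrow> fst z"
    by real_asymp
  then have "(\<lambda>n. max 0 (?g n (fst z))) \<longlonglongrightarrow> max 0 (fst z)"
    by (intro tendsto_intros)
  then have "(\<lambda>n. B (max 0 (?g n (fst z))) (snd z)) \<longlonglongrightarrow> B (max 0 (fst z)) (snd z)"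
    by (intro continuous_on_tendsto_compose[OF continuous_paths[OF \<omega>]]) auto
  then show "(\<lambda>n. B (max 0 (?g n (fst z))) (snd z)) \<longlonglongrightarrow> (case z of (s, \<omega>) \<Rightarrow> B (max 0 s) \<omega>)"
    by (simp add: case_prod_beta)
qed

end

text \<open>The integral of a path against a finite measure \<open>N\<close> on \<open>(0, t]\<close>, an abstraction of
  \<open>\<integral>\<^sub>0\<^sup>t e\<^sup>s B\<^sub>s ds\<close>.\<close>

locale fbm_path_integral = fractional_brownian_motion M H B + N: finite_bounded_law N t
  for M :: "'a measure" and H :: real and B :: "real \<Rightarrow> 'a \<Rightarrow> real"
    and N :: "real measure" and t :: real
begin

sublocale P: pair_sigma_finite N M
  by unfold_locales

definition J :: "'a \<Rightarrow> real" where
  "J \<omega> = (\<integral>s. B (max 0 s) \<omega> \<partial>N)"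

lemma measurable_pair_N [measurable]:
  "(\<lambda>z. B (max 0 (fst z)) (snd z)) \<in> borel_measurable (N \<Otimes>\<^sub>M M)"
proof -
  have "sets (N \<Otimes>\<^sub>M M) = sets (borel \<Otimes>\<^sub>M M)" by (intro sets_pair_measure_cong) auto
  with measurable_B_pair show ?thesis
    by (simp add: case_prod_beta cong: measurable_cong_sets)
qed

lemma measurable_max_B [measurable]: "B (max 0 s) \<in> borel_measurable M"
  by (rule measurable_B) simp

lemma measurable_J [measurable]: "J \<in> borel_measurable M"
proof -
  have "(\<lambda>z. B (max 0 (snd z)) (fst z)) \<in> borel_measurable (M \<Otimes>\<^sub>M N)"
    using measurable_compose[OF measurable_pair_swap' measurable_pair_N] by (simp add: case_prod_beta)
  then show ?thesis
    unfolding J_def[abs_def] by (intro N.borel_measurable_lebesgue_integral) (simp add: case_prod_beta)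
qed

lemma integrable_square_pair: "integrable (N \<Otimes>\<^sub>M M) (\<lambda>z. (B (max 0 (fst z)) (snd z))\<^sup>2)"
proof (rule P.Fubini_integrable)
  have "integrable N (\<lambda>s. \<integral>\<omega>. norm ((B (max 0 (fst (s, \<omega>))) (snd (s, \<omega>)))\<^sup>2) \<partial>M) \<longleftrightarrow>
    integrable N (\<lambda>s. s powr (2 * H))"
  proof (rule integrable_cong_AE)
    show "AE s in N. (\<integral>\<omega>. norm ((B (max 0 (fst (s, \<omega>))) (snd (s, \<omega>)))\<^sup>2) \<partial>M) = s powr (2 * H)"
      using N.AE_support by eventually_elim (simp add: expectation_square_B)
    show "(\<lambda>s. \<integral>\<omega>. norm ((B (max 0 (fst (s, \<omega>))) (snd (s, \<omega>)))\<^sup>2) \<partial>M) \<in> borel_measurable N"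
      by (rule borel_measurable_lebesgue_integral) (simp add: case_prod_beta')
    show "(\<lambda>s. s powr (2 * H)) \<in> borel_measurable N" by measurable
  qed
  then show "integrable N (\<lambda>s. \<integral>\<omega>. norm ((B (max 0 (fst (s, \<omega>))) (snd (s, \<omega>)))\<^sup>2) \<partial>M)"
    using Hurst_index by (simp add: N.integrable_powr)
  show "AE s in N. integrable M (\<lambda>\<omega>. (B (max 0 (fst (s, \<omega>))) (snd (s, \<omega>)))\<^sup>2)"
    using N.AE_support by eventually_elim (simp add: integrable_square_B)
qed measurable

text \<open>Pathwise Cauchy-Schwarz reduces this to the integrability of \<open>(B\<^sub>s)\<^sup>2\<close> on the product space.\<close>

lemma integrable_square_J: "integrable M (\<lambda>\<omega>. (J \<omega>)\<^sup>2)"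
proof (rule Bochner_Integration.integrable_bound)
  show "integrable M (\<lambda>\<omega>. measure N (space N) * (\<integral>s. (B (max 0 s) \<omega>)\<^sup>2 \<partial>N))"
    using P.integrable_snd[of "\<lambda>s \<omega>. (B (max 0 s) \<omega>)\<^sup>2"] integrable_square_pair
    by (simp add: case_prod_beta')
  have "AE \<omega> in M. integrable N (\<lambda>s. (B (max 0 s) \<omega>)\<^sup>2)"
    using P.AE_integrable_snd[of "\<lambda>s \<omega>. (B (max 0 s) \<omega>)\<^sup>2"] integrable_square_pair
    by (simp add: case_prod_beta')
  with AE_space show "AE \<omega> in M. norm ((J \<omega>)\<^sup>2) \<le> norm (measure N (space N) * (\<integral>s. (B (max 0 s) \<omega>)\<^sup>2 \<partial>N))"
  proof eventually_elim
    case (elim \<omega>)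
    have "(\<lambda>s. B (max 0 s) \<omega>) \<in> borel_measurable N"
      using measurable_compose[OF measurable_Pair2' measurable_pair_N] elim by simp
    from N.square_integral_le[OF this] elim show ?case
      by (simp add: J_def)
  qed
qed measurable

lemma expectation_mult_J:
  assumes [measurable]: "Z \<in> borel_measurable M" and Z: "integrable M (\<lambda>\<omega>. (Z \<omega>)\<^sup>2)"
  shows "expectation (\<lambda>\<omega>. Z \<omega> * J \<omega>) = (\<integral>s. expectation (\<lambda>\<omega>. Z \<omega> * B (max 0 s) \<omega>) \<partial>N)"
proof -
  have "integrable (N \<Otimes>\<^sub>M M) (\<lambda>z. (Z (snd z))\<^sup>2)"
    using Z by (intro P.Fubini_integrable) auto
  then have "integrable (N \<Otimes>\<^sub>M M) (\<lambda>z. (Z (snd z))\<^sup>2 + (B (max 0 (fst z)) (snd z))\<^sup>2)"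
    using integrable_square_pair by (rule Bochner_Integration.integrable_add)
  then have "integrable (N \<Otimes>\<^sub>M M) (\<lambda>z. Z (snd z) * B (max 0 (fst z)) (snd z))"
  proof (rule Bochner_Integration.integrable_bound)
    show "AE z in N \<Otimes>\<^sub>M M. norm (Z (snd z) * B (max 0 (fst z)) (snd z))
        \<le> norm ((Z (snd z))\<^sup>2 + (B (max 0 (fst z)) (snd z))\<^sup>2)"
      using abs_mult_le_sum_squares by (auto simp: abs_of_nonneg add_nonneg_nonneg)
  qed measurable
  then have "(\<integral>\<omega>. (\<integral>s. Z \<omega> * B (max 0 s) \<omega> \<partial>N) \<partial>M) = (\<integral>s. (\<integral>\<omega>. Z \<omega> * B (max 0 s) \<omega> \<partial>M) \<partial>N)"
    by (intro P.Fubini_integral) (simp add: case_prod_beta')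
  then show ?thesis by (simp add: J_def)
qed

lemma integrable_mult_square:
  fixes X Y :: "'a \<Rightarrow> real"
  assumes "X \<in> borel_measurable M" "Y \<in> borel_measurable M"
    and "integrable M (\<lambda>\<omega>. (X \<omega>)\<^sup>2)" "integrable M (\<lambda>\<omega>. (Y \<omega>)\<^sup>2)"
  shows "integrable M (\<lambda>\<omega>. X \<omega> * Y \<omega>)"
proof (rule Bochner_Integration.integrable_bound)
  show "integrable M (\<lambda>\<omega>. (X \<omega>)\<^sup>2 + (Y \<omega>)\<^sup>2)" using assms by simp
  show "AE \<omega> in M. norm (X \<omega> * Y \<omega>) \<le> norm ((X \<omega>)\<^sup>2 + (Y \<omega>)\<^sup>2)"
    using abs_mult_le_sum_squares by (auto simp: abs_of_nonneg add_nonneg_nonneg)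
qed (use assms in auto)

text \<open>With \<open>Y = a B\<^sub>t - J\<close>, expanding only one factor of \<open>Y\<^sup>2\<close> gives
  \<open>E Y\<^sup>2 = a E (Y B\<^sub>t) - \<integral> E (Y B\<^sub>u) dN(u)\<close>, and \<open>c u = E (Y B\<^sub>u)\<close> is in turn an integral of the covariance. Thus
  two applications of Fubini's theorem on a product of two spaces replace one on a product of three.\<close>

lemma expectation_square_B_minus_J:
  fixes a :: real
  assumes t: "0 < t"
  defines "c \<equiv> \<lambda>u. a * fbm_cov (2 * H) t u - (\<integral>s. fbm_cov (2 * H) (max 0 s) u \<partial>N)"
  shows "expectation (\<lambda>\<omega>. (a * B t \<omega> - J \<omega>)\<^sup>2) = a * c t - (\<integral>u. c (max 0 u) \<partial>N)"
proof -
  let ?Y = "\<lambda>\<omega>. a * B t \<omega> - J \<omega>"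
  have Bt [measurable]: "B t \<in> borel_measurable M" using t by (intro measurable_B) simp
  note sq_t = integrable_square_B[OF t]
  have BJ: "integrable M (\<lambda>\<omega>. B t \<omega> * J \<omega>)"
    by (rule integrable_mult_square[OF Bt measurable_J sq_t integrable_square_J])
  have Y2: "integrable M (\<lambda>\<omega>. (?Y \<omega>)\<^sup>2)"
  proof -
    have "(\<lambda>\<omega>. (?Y \<omega>)\<^sup>2) = (\<lambda>\<omega>. a\<^sup>2 * (B t \<omega>)\<^sup>2 - 2 * a * (B t \<omega> * J \<omega>) + (J \<omega>)\<^sup>2)"
      by (simp add: fun_eq_iff power2_diff power_mult_distrib)
    then show ?thesis using sq_t BJ integrable_square_J by simp
  qed
  have YB: "expectation (\<lambda>\<omega>. ?Y \<omega> * B u \<omega>) = c u" if "0 < u" for u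
  proof -
    have Bu [measurable]: "B u \<in> borel_measurable M" using that by (intro measurable_B) simp
    note sq_u = integrable_square_B[OF that]
    have "?Y \<omega> * B u \<omega> = a * (B u \<omega> * B t \<omega>) - B u \<omega> * J \<omega>" for \<omega>
      by (simp add: algebra_simps)
    then have "expectation (\<lambda>\<omega>. ?Y \<omega> * B u \<omega>) = expectation (\<lambda>\<omega>. a * (B u \<omega> * B t \<omega>) - B u \<omega> * J \<omega>)"
      by (simp only:)
    also have "\<dots> = a * expectation (\<lambda>\<omega>. B u \<omega> * B t \<omega>) - expectation (\<lambda>\<omega>. B u \<omega> * J \<omega>)"
      using integrable_mult_square[OF Bu Bt sq_u sq_t] integrable_mult_square[OF Bu measurable_J sq_u integrable_square_J]
      by simp
    also have "\<dots> = c u"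
      using that t by (simp add: c_def expectation_mult_J sq_u expectation_product)
    finally show ?thesis .
  qed
  have "(?Y \<omega>)\<^sup>2 = a * (?Y \<omega> * B t \<omega>) - ?Y \<omega> * J \<omega>" for \<omega>
    by (simp add: power2_eq_square algebra_simps)
  then have "expectation (\<lambda>\<omega>. (?Y \<omega>)\<^sup>2) = expectation (\<lambda>\<omega>. a * (?Y \<omega> * B t \<omega>) - ?Y \<omega> * J \<omega>)"
    by (simp only:)
  also have "\<dots> = a * expectation (\<lambda>\<omega>. ?Y \<omega> * B t \<omega>) - expectation (\<lambda>\<omega>. ?Y \<omega> * J \<omega>)"
    using integrable_mult_square[OF _ Bt Y2 sq_t] integrable_mult_square[OF _ measurable_J Y2 integrable_square_J]
    by simp
  also have "expectation (\<lambda>\<omega>. ?Y \<omega> * J \<omega>) = (\<integral>u. expectation (\<lambda>\<omega>. ?Y \<omega> * B (max 0 u) \<omega>) \<partial>N)"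
    by (rule expectation_mult_J[OF _ Y2]) measurable
  also have "\<dots> = (\<integral>u. c (max 0 u) \<partial>N)"
  proof (rule integral_cong_AE)
    show "AE u in N. expectation (\<lambda>\<omega>. ?Y \<omega> * B (max 0 u) \<omega>) = c (max 0 u)"
      using N.AE_support by eventually_elim (simp add: YB)
    show "(\<lambda>u. c (max 0 u)) \<in> borel_measurable N"
      unfolding c_def fbm_cov_def by measurable
  qed measurable
  finally show ?thesis using YB[OF t] by simp
qed

end

section \<open>The second moment as a single integral\<close>

text \<open>All integrals of the covariance against exponentials are expressed through the cases \<open>c = 1\<close> and
  \<open>c = -1\<close>.\<close>

definition exp_power_integral :: "real \<Rightarrow> real \<Rightarrow> real \<Rightarrow> real" where
  "exp_power_integral p c u = integral {0..u} (\<lambda>x. exp (c * x) * x powr p)"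

lemma continuous_on_exp_power_integrand:
  assumes "0 < p"
  shows "continuous_on {0..} (\<lambda>x::real. exp (c * x) * x powr p)"
  using assms by (intro continuous_intros continuous_on_powr') auto

lemma exp_power_integral_0 [simp]: "exp_power_integral p c 0 = 0"
  by (simp add: exp_power_integral_def)

lemma continuous_on_exp_power_integral:
  assumes "0 < p"
  shows "continuous_on {0..b} (exp_power_integral p c)"
  unfolding exp_power_integral_def[abs_def]
  by (intro indefinite_integral_continuous_1 integrable_continuous_interval
      continuous_on_subset[OF continuous_on_exp_power_integrand[OF assms]]) auto

lemma continuous_on_exp_power_integral_compose:
  assumes "0 < p" "continuous_on A f" "f ` A \<subseteq> {0..b}"
  shows "continuous_on A (\<lambda>x. exp_power_integral p c (f x))"
  using continuous_on_compose2[OF continuous_on_exp_power_integral[OF assms(1)] assms(2,3)] .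

lemma has_real_derivative_exp_power_integral:
  assumes "0 < p" "0 < f x" "(f has_real_derivative f') (at x)"
  shows "((\<lambda>x. exp_power_integral p c (f x)) has_real_derivative
      exp (c * f x) * f x powr p * f') (at x)"
proof -
  have "(exp_power_integral p c has_real_derivative exp (c * f x) * f x powr p) (at (f x))"
    unfolding exp_power_integral_def[abs_def]
    by (rule has_real_derivative_integral[OF continuous_on_exp_power_integrand[OF assms(1)] assms(2)])
  from DERIV_chain2[OF this assms(3)] show ?thesis .
qed

lemma continuous_on_fbm_cov:
  assumes "0 < p" "0 \<le> u"
  shows "continuous_on {0..t} (\<lambda>s. fbm_cov p s u)"
  unfolding fbm_cov_def using assms by (intro continuous_intros continuous_on_powr') auto

text \<open>Split at \<open>u\<close>; on each side the substitution \<open>x = \<bar>u - s\<bar>\<close> produces one of the two basic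
  integrals.\<close>

lemma integral_exp_abs_diff_powr:
  assumes p: "0 < p" and u: "0 \<le> u" "u \<le> t"
  shows "integral {0..t} (\<lambda>s. exp s * \<bar>u - s\<bar> powr p)
    = exp u * (exp_power_integral p (-1) u + exp_power_integral p 1 (t - u))"
proof -
  have "integral {0..t} (\<lambda>s. exp s * \<bar>u - s\<bar> powr p)
     = integral {0..u} (\<lambda>s. exp s * \<bar>u - s\<bar> powr p) + integral {u..t} (\<lambda>s. exp s * \<bar>u - s\<bar> powr p)"
    using assms
    by (intro Henstock_Kurzweil_Integration.integral_combine[symmetric] integrable_continuous_interval
        continuous_intros continuous_on_powr') auto
  also have "integral {0..u} (\<lambda>s. exp s * \<bar>u - s\<bar> powr p)
      = - (exp u * exp_power_integral p (-1) (u - u)) - - (exp u * exp_power_integral p (-1) (u - 0))"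
  proof (rule integral_FTC_real)
    show "continuous_on {0..u} (\<lambda>s. - (exp u * exp_power_integral p (-1) (u - s)))"
      using p by (intro continuous_intros continuous_on_exp_power_integral_compose[where b = u]) auto
    show "((\<lambda>s. - (exp u * exp_power_integral p (-1) (u - s))) has_real_derivative exp s * \<bar>u - s\<bar> powr p) (at s)"
      if "0 < s" "s < u" for s
      using p that
      by (auto intro!: derivative_eq_intros has_real_derivative_exp_power_integral
          simp: mult.assoc[symmetric] exp_add[symmetric])
  qed fact
  also have "integral {u..t} (\<lambda>s. exp s * \<bar>u - s\<bar> powr p)
      = exp u * exp_power_integral p 1 (t - u) - exp u * exp_power_integral p 1 (u - u)"
  proof (rule integral_FTC_real)
    show "continuous_on {u..t} (\<lambda>s. exp u * exp_power_integral p 1 (s - u))"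
      using p by (intro continuous_intros continuous_on_exp_power_integral_compose[where b = "t - u"]) auto
    show "((\<lambda>s. exp u * exp_power_integral p 1 (s - u)) has_real_derivative exp s * \<bar>u - s\<bar> powr p) (at s)"
      if "u < s" "s < t" for s
      using p that
      by (auto intro!: derivative_eq_intros has_real_derivative_exp_power_integral
          simp: mult.assoc[symmetric] exp_add[symmetric])
  qed fact
  finally show ?thesis by (simp add: algebra_simps)
qed

lemma integral_exp_fbm_cov:
  assumes p: "0 < p" and u: "0 \<le> u" "u \<le> t"
  shows "integral {0..t} (\<lambda>s. exp s * fbm_cov p s u)
    = (exp_power_integral p 1 t + u powr p * (exp t - 1)
        - exp u * (exp_power_integral p (-1) u + exp_power_integral p 1 (t - u))) / 2"
proof -
  have cov: "(\<lambda>s. exp s * fbm_cov p s u)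
     = (\<lambda>s. (u powr p * exp s + exp (1 * s) * s powr p - exp s * \<bar>u - s\<bar> powr p) / 2)"
    by (simp add: fbm_cov_def fun_eq_iff algebra_simps add_divide_distrib diff_divide_distrib)
  have "integral {0..t} (exp :: real \<Rightarrow> real) = exp t - 1"
    using u integral_FTC_real[of 0 t exp exp] by (auto intro!: derivative_eq_intros continuous_intros)
  moreover have "(exp :: real \<Rightarrow> real) integrable_on {0..t}"
    by (intro integrable_continuous_interval continuous_intros)
  ultimately have exp: "((\<lambda>s. exp s) has_integral exp t - 1) {0..t}"
    using integrable_integral by metis
  have pow: "((\<lambda>s. exp (1 * s) * s powr p) has_integral exp_power_integral p 1 t) {0..t}"
    unfolding exp_power_integral_def
    by (intro integrable_integral integrable_continuous_interval
        continuous_on_subset[OF continuous_on_exp_power_integrand[OF p]]) auto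
  have "(\<lambda>s. exp s * \<bar>u - s\<bar> powr p) integrable_on {0..t}"
    using p by (intro integrable_continuous_interval continuous_intros continuous_on_powr') auto
  from integrable_integral[OF this] have dist: "((\<lambda>s. exp s * \<bar>u - s\<bar> powr p) has_integral
      exp u * (exp_power_integral p (-1) u + exp_power_integral p 1 (t - u))) {0..t}"
    by (simp only: integral_exp_abs_diff_powr[OF assms])
  have "((\<lambda>s. exp s * fbm_cov p s u) has_integral
      (u powr p * (exp t - 1) + exp_power_integral p 1 t
        - exp u * (exp_power_integral p (-1) u + exp_power_integral p 1 (t - u))) / 2) {0..t}"
    unfolding cov by (rule has_integral_divide has_integral_diff has_integral_add has_integral_mult_right exp pow dist)+
  then show ?thesis by (simp add: integral_unique add.commute)
qed

text \<open>The \<open>p\<close>-th moment of \<open>\<mu>\<^sub>t = \<delta>\<^sub>t + sinh (t - x) dx\<close>, for \<open>p > 0\<close>, where the integrand is continuous up to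
  the end point \<open>0\<close>.\<close>

definition riemann_sinh_moment :: "real \<Rightarrow> real \<Rightarrow> real" where
  "riemann_sinh_moment t p = t powr p + integral {0..t} (\<lambda>x. x powr p * sinh (t - x))"

lemma exp_mult_riemann_sinh_moment:
  assumes "0 < p" "0 < t"
  shows "exp t * riemann_sinh_moment t p
    = exp t * t powr p + (exp (2 * t) * exp_power_integral p (-1) t - exp_power_integral p 1 t) / 2"
proof -
  have "(\<lambda>x. x powr p * sinh (t - x))
      = (\<lambda>x. (exp t * (exp (-1 * x) * x powr p) - exp (- t) * (exp (1 * x) * x powr p)) / 2)"
    by (auto simp: sinh_def fun_eq_iff exp_diff exp_minus field_simps)
  moreover have "(\<lambda>x. exp (c * x) * x powr p) integrable_on {0..t}" for c
    by (intro integrable_continuous_interval continuous_on_subset[OF continuous_on_exp_power_integrand]) (use assms in auto)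
  ultimately have "integral {0..t} (\<lambda>x. x powr p * sinh (t - x))
    = (exp t * exp_power_integral p (-1) t - exp (- t) * exp_power_integral p 1 t) / 2"
    unfolding exp_power_integral_def
    by (simp only: integral_divide integral_diff integrable_on_mult_right integral_mult_right)
  moreover have "exp (2 * t) = exp t * exp t" by (simp add: exp_add[symmetric])
  ultimately show ?thesis
    by (simp add: riemann_sinh_moment_def field_simps exp_minus)
qed

text \<open>Here \<open>c u\<close> is the covariance of the path integral with \<open>B\<^sub>u\<close>. In terms of
  \<open>L(u) = \<integral>\<^sub>0\<^sup>u e\<^sup>x x\<^sup>p dx\<close> and \<open>M(u) = \<integral>\<^sub>0\<^sup>u e\<^bsup>-x\<^esup> x\<^sup>p dx\<close> it is elementary, and
  \<open>e\<^sup>u c(u)\<close> has an antiderivative of the same kind. The contributions of \<open>L\<close> and \<open>M\<close> at \<open>0\<close> and \<open>t\<close>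
  mostly cancel.\<close>

lemma second_moment_identity:
  assumes p: "0 < p" and t: "0 < t"
  defines "c \<equiv> \<lambda>u. exp t * fbm_cov p t u - integral {0..t} (\<lambda>s. exp s * fbm_cov p s u)"
  shows "exp t * c t - integral {0..t} (\<lambda>u. exp u * c u) = exp t * riemann_sinh_moment t p"
    and "continuous_on {0..t} (\<lambda>u. exp u * c u)"
proof -
  let ?L = "exp_power_integral p 1" and ?M = "exp_power_integral p (-1)"
  define c' where "c' u = (exp t * t powr p + u powr p - exp t * (t - u) powr p - ?L t
      + exp u * (?M u + ?L (t - u))) / 2" for u
  have c: "c u = c' u" if "u \<in> {0..t}" for u
  proof -
    have "fbm_cov p t u = (u powr p + t powr p - (t - u) powr p) / 2"
      using that by (simp add: fbm_cov_def)
    moreover have "0 \<le> u" "u \<le> t" using that by auto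
    note integral_exp_fbm_cov[OF p this]
    ultimately show ?thesis
      unfolding c_def c'_def by (simp only:) (simp add: field_simps)
  qed
  have "continuous_on {0..t} (\<lambda>u. exp u * c' u)"
    unfolding c'_def using p
    by (intro continuous_intros continuous_on_exp_power_integral_compose[where b = t] continuous_on_powr') auto
  moreover have "continuous_on {0..t} (\<lambda>u. exp u * c u) \<longleftrightarrow> continuous_on {0..t} (\<lambda>u. exp u * c' u)"
    by (rule continuous_on_cong) (use c in auto)
  ultimately show "continuous_on {0..t} (\<lambda>u. exp u * c u)" by simp
  \<comment> \<open>Found by integrating \<open>e\<^bsup>2u\<^esup> (M u + L (t - u))\<close> by parts; the last two terms integrate the remainders
        \<open>e\<^sup>u u\<^sup>p / 2\<close> and \<open>- e\<^bsup>t+u\<^esup> (t - u)\<^sup>p / 2\<close>.\<close>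
  define F where "F u = (exp u * (exp t * t powr p - ?L t) + exp (2 * u) / 2 * (?M u + ?L (t - u))
      + ?L u / 2 + exp (2 * t) / 2 * ?M (t - u)) / 2" for u
  have "integral {0..t} (\<lambda>u. exp u * c u) = integral {0..t} (\<lambda>u. exp u * c' u)"
    using c by (intro integral_cong) simp
  also have "\<dots> = F t - F 0"
  proof (rule integral_FTC_real)
    show "continuous_on {0..t} F"
      unfolding F_def[abs_def] using p
      by (intro continuous_intros continuous_on_exp_power_integral_compose[where b = t]) auto
    show "(F has_real_derivative exp u * c' u) (at u)" if u: "0 < u" "u < t" for u
    proof -
      have *: "(exp_power_integral p c has_real_derivative exp (c * u) * u powr p) (at u)"
        "((\<lambda>u. exp_power_integral p c (t - u)) has_real_derivative
           - (exp (c * (t - u)) * (t - u) powr p)) (at u)" for c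
        using u has_real_derivative_exp_power_integral[OF p, of "\<lambda>u. u" u 1]
          has_real_derivative_exp_power_integral[OF p, of "\<lambda>u. t - u" u "-1"]
          DERIV_diff[OF DERIV_const DERIV_ident, of t u]
        by simp_all
      have deriv_L: "(?L has_real_derivative exp u * u powr p) (at u)"
        and deriv_M: "(?M has_real_derivative exp (- u) * u powr p) (at u)"
        and deriv_L': "((\<lambda>u. ?L (t - u)) has_real_derivative - (exp (t - u) * (t - u) powr p)) (at u)"
        and deriv_M': "((\<lambda>u. ?M (t - u)) has_real_derivative - (exp (u - t) * (t - u) powr p)) (at u)"
        using *[of 1] *[of "-1"] by simp_all
      \<comment> \<open>With names for the two exponentials the claim becomes an identity of rational functions.\<close>
      define a b where "a = exp u" and "b = exp t"
      have exps: "exp u = a" "exp t = b" "exp (2 * u) = a\<^sup>2" "exp (2 * t) = b\<^sup>2"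
        "exp (- u) = 1 / a" "exp (t - u) = b / a" "exp (u - t) = a / b" and nz: "a \<noteq> 0" "b \<noteq> 0"
        by (simp_all add: a_def b_def exp_double exp_diff exp_minus divide_inverse)
      show ?thesis
        unfolding F_def[abs_def] c'_def
        by (rule derivative_eq_intros deriv_L deriv_M deriv_L' deriv_M' refl zero_neq_numeral[symmetric])+
           (unfold exps, use nz in \<open>simp add: field_simps power2_eq_square\<close>)
    qed
  qed (use t in simp)
  finally have *: "integral {0..t} (\<lambda>u. exp u * c u) = F t - F 0" .
  have ct: "c t = c' t" using c[of t] t by simp
  have e: "exp (2 * t) = exp t * exp t" by (simp add: exp_add[symmetric])
  show "exp t * c t - integral {0..t} (\<lambda>u. exp u * c u) = exp t * riemann_sinh_moment t p"
    unfolding * exp_mult_riemann_sinh_moment[OF p t] F_def e ct c'_def by (simp add: field_simps)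
qed

lemma expectation_exp_integral:
  assumes "fractional_brownian_motion M H B" and t: "0 < t"
  shows "prob_space.expectation M (\<lambda>\<omega>. (exp_integral B t \<omega>)\<^sup>2) = exp t * riemann_sinh_moment t (2 * H)"
proof -
  let ?N = "weighted_law exp t"
  have expw: "(exp :: real \<Rightarrow> real) \<in> borel_measurable borel" "continuous_on {0..t} (exp :: real \<Rightarrow> real)"
    "\<And>x. x \<in> {0..t} \<Longrightarrow> 0 \<le> (exp x :: real)"
    by (auto intro!: continuous_intros borel_measurable_continuous_onI)
  interpret fractional_brownian_motion M H B by fact
  interpret N: finite_bounded_law ?N t by (rule finite_bounded_weighted_law[OF expw])
  interpret fbm_path_integral M H B ?N t ..
  note integral_N = integral_weighted_law[OF expw]
  have p: "0 < 2 * H" using Hurst_index by simp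
  have path: "exp_integral B t \<omega> = exp t * B t \<omega> - J \<omega>" if "\<omega> \<in> space M" for \<omega>
  proof -
    have cont: "continuous_on UNIV (\<lambda>s. B (max 0 s) \<omega>)"
      by (rule continuous_on_compose2[OF continuous_paths[OF that]]) (auto intro!: continuous_intros)
    have cont': "continuous_on {0..t} (\<lambda>s. exp s * B s \<omega>)"
      by (intro continuous_intros continuous_on_subset[OF continuous_paths[OF that]]) auto
    have "J \<omega> = integral {0..t} (\<lambda>s. exp s * B (max 0 s) \<omega>)"
      unfolding J_def
      by (intro integral_N borel_measurable_continuous_onI cont continuous_intros continuous_on_subset[OF cont]) auto
    also have "\<dots> = integral {0..t} (\<lambda>s. exp s * B s \<omega>)"
      by (intro integral_cong) simp
    also have "\<dots> = (LBINT s:{0..t}. exp s * B s \<omega>)"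
      by (rule set_borel_integral_eq_integral(2)[symmetric, OF borel_integrable_atLeastAtMost'[OF cont']])
    finally show ?thesis by (simp add: exp_integral_def)
  qed
  define c where "c u = exp t * fbm_cov (2 * H) t u - (\<integral>s. fbm_cov (2 * H) (max 0 s) u \<partial>?N)" for u
  define d where "d u = exp t * fbm_cov (2 * H) t u - integral {0..t} (\<lambda>s. exp s * fbm_cov (2 * H) s u)" for u
  have cd: "c u = d u" if "0 \<le> u" for u
  proof -
    have eq: "exp s * fbm_cov (2 * H) (max 0 s) u = exp s * fbm_cov (2 * H) s u" if "s \<in> {0..t}" for s
      using that by simp
    have "(\<lambda>s. fbm_cov (2 * H) (max 0 s) u) \<in> borel_measurable borel"
      unfolding fbm_cov_def by measurable
    moreover have "continuous_on {0..t} (\<lambda>s. exp s * fbm_cov (2 * H) (max 0 s) u)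
        \<longleftrightarrow> continuous_on {0..t} (\<lambda>s. exp s * fbm_cov (2 * H) s u)"
      by (rule continuous_on_cong) (use eq in auto)
    moreover have "continuous_on {0..t} (\<lambda>s. exp s * fbm_cov (2 * H) s u)"
      by (intro continuous_intros continuous_on_fbm_cov p that)
    ultimately have "(\<integral>s. fbm_cov (2 * H) (max 0 s) u \<partial>?N)
        = integral {0..t} (\<lambda>s. exp s * fbm_cov (2 * H) (max 0 s) u)"
      by (intro integral_N) auto
    also have "\<dots> = integral {0..t} (\<lambda>s. exp s * fbm_cov (2 * H) s u)"
      by (intro integral_cong eq)
    finally show ?thesis by (simp add: c_def d_def)
  qed
  have "(\<integral>u. c (max 0 u) \<partial>?N) = integral {0..t} (\<lambda>u. exp u * c (max 0 u))"
  proof (rule integral_N)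
    show "(\<lambda>u. c (max 0 u)) \<in> borel_measurable borel"
      unfolding c_def fbm_cov_def by measurable
    have "continuous_on {0..t} (\<lambda>u. exp u * c (max 0 u)) \<longleftrightarrow> continuous_on {0..t} (\<lambda>u. exp u * d u)"
      by (rule continuous_on_cong) (use cd in auto)
    then show "continuous_on {0..t} (\<lambda>u. exp u * c (max 0 u))"
      using second_moment_identity(2)[OF p t] by (simp add: d_def)
  qed
  also have "\<dots> = integral {0..t} (\<lambda>u. exp u * d u)"
    by (intro integral_cong) (use cd in auto)
  finally have *: "(\<integral>u. c (max 0 u) \<partial>?N) = integral {0..t} (\<lambda>u. exp u * d u)" .
  have "expectation (\<lambda>\<omega>. (exp_integral B t \<omega>)\<^sup>2) = expectation (\<lambda>\<omega>. (exp t * B t \<omega> - J \<omega>)\<^sup>2)"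
    by (intro Bochner_Integration.integral_cong refl) (simp add: path)
  also have "\<dots> = exp t * c t - (\<integral>u. c (max 0 u) \<partial>?N)"
    unfolding c_def by (rule expectation_square_B_minus_J[OF t])
  also have "\<dots> = exp t * d t - integral {0..t} (\<lambda>u. exp u * d u)"
    using cd[of t] t * by simp
  also have "\<dots> = exp t * riemann_sinh_moment t (2 * H)"
    unfolding d_def by (rule second_moment_identity(1)[OF p t])
  finally show ?thesis .
qed

section \<open>The slope at Hurst index one half\<close>

lemma continuous_on_x_ln_x: "continuous_on {0..} (\<lambda>x::real. x * ln x)"
  unfolding continuous_on
proof
  fix x :: real assume "x \<in> {0..}"
  then consider "x = 0" | "x > 0" by force
  then show "((\<lambda>x. x * ln x) \<longlongrightarrow> x * ln x) (at x within {0..})"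
  proof cases
    case 1
    have "((\<lambda>x::real. x * ln x) \<longlongrightarrow> 0) (at_right 0)" by real_asymp
    with 1 show ?thesis by (simp add: at_within_Ici_at_right)
  next
    case 2
    then show ?thesis by (intro tendsto_intros) auto
  qed
qed

text \<open>The function called \<open>D\<close> in the introduction: half of
  \<open>e\<^bsup>-t\<^esup>\<close> times the derivative of the second moment in \<open>H\<close> at \<open>H = 1/2\<close>.\<close>

definition slope_half :: "real \<Rightarrow> real" where
  "slope_half t = t * ln t + integral {0..t} (\<lambda>x. x * ln x * sinh (t - x))"

text \<open>Replace \<open>x ln x\<close> by the larger \<open>x\<^sup>2 - x\<close>, for which the integral is elementary.\<close>

lemma slope_half_upper_bound:
  assumes "0 < t"
  shows "slope_half t \<le> 2 * cosh t - sinh t - 2"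
proof -
  have "integral {0..t} (\<lambda>x. x * ln x * sinh (t - x)) \<le> integral {0..t} (\<lambda>x. (x\<^sup>2 - x) * sinh (t - x))"
  proof (rule integral_le)
    show "x * ln x * sinh (t - x) \<le> (x\<^sup>2 - x) * sinh (t - x)" if "x \<in> {0..t}" for x
    proof (cases "x = 0")
      case False
      with that have "x * ln x \<le> x * (x - 1)"
        by (intro mult_left_mono ln_le_minus_one) auto
      with that show ?thesis
        by (intro mult_right_mono) (auto simp: algebra_simps power2_eq_square)
    qed simp
  qed (intro integrable_continuous_interval continuous_intros continuous_on_subset[OF continuous_on_x_ln_x]; auto)+
  also have "\<dots> = - (t\<^sup>2 - t) - 2 - (sinh t - 2 * cosh t)"
    using assms
    by (subst integral_FTC_real[where F = "\<lambda>x. - (x\<^sup>2 - x) * cosh (t - x) - (2 * x - 1) * sinh (t - x) - 2 * cosh (t - x)"])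
       (auto intro!: continuous_intros derivative_eq_intros simp: algebra_simps)
  also have "t * ln t \<le> t\<^sup>2 - t"
    using mult_left_mono[OF ln_le_minus_one[OF assms], of t] assms
    by (simp add: algebra_simps power2_eq_square)
  ultimately show ?thesis by (simp add: slope_half_def)
qed

text \<open>The upper bound equals \<open>(e\<^sup>t - 1) (e\<^sup>t - 3) / (2 e\<^sup>t)\<close>, which is negative as long as \<open>e\<^sup>t < 3\<close>.\<close>

lemma slope_half_neg:
  assumes "0 < t" "t \<le> 1"
  shows "slope_half t < 0"
proof -
  have "exp t \<le> exp (1::real)" using assms by simp
  also have "\<dots> < 3" using e_less_272 by simp
  finally have "(exp t - 1) * (exp t - 3) < 0"
    using assms by (intro mult_pos_neg) auto
  moreover have "2 * cosh t - sinh t - 2 = (exp t - 1) * (exp t - 3) / (2 * exp t)"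
    by (simp add: cosh_def sinh_def field_simps exp_minus power2_eq_square)
  ultimately have "2 * cosh t - sinh t - 2 < 0"
    by (simp add: divide_neg_pos)
  with slope_half_upper_bound[OF assms(1)] show ?thesis by simp
qed

text \<open>The bound \<open>x ln x \<ge> x - 1\<close> gives \<open>D(t) \<ge> t ln t - t + 1 - e\<^bsup>-t\<^esup>\<close>, and the first two terms cancel at
  \<open>t = e\<close>.\<close>

lemma slope_half_exp_1_pos: "slope_half (exp 1) > 0"
proof -
  define t :: real where "t = exp 1"
  have t: "t > 0" "t * ln t = t" by (auto simp: t_def)
  have "integral {0..t} (\<lambda>x. (x - 1) * sinh (t - x)) \<le> integral {0..t} (\<lambda>x. x * ln x * sinh (t - x))"
  proof (rule integral_le)
    show "(x - 1) * sinh (t - x) \<le> x * ln x * sinh (t - x)" if "x \<in> {0..t}" for x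
    proof (rule mult_right_mono)
      show "x - 1 \<le> x * ln x"
      proof (cases "x = 0")
        case False
        with that have x: "x > 0" by auto
        then have "ln (1 / x) \<le> 1 / x - 1" by (intro ln_le_minus_one) auto
        with x show ?thesis by (simp add: ln_div field_simps)
      qed simp
    qed (use that in auto)
  qed (intro integrable_continuous_interval continuous_intros continuous_on_subset[OF continuous_on_x_ln_x]; auto)+
  moreover have "integral {0..t} (\<lambda>x. (x - 1) * sinh (t - x)) = 1 - t - (cosh t - sinh t)"
    using t
    by (subst integral_FTC_real[where F = "\<lambda>x. - (x - 1) * cosh (t - x) - sinh (t - x)"])
       (auto intro!: continuous_intros derivative_eq_intros simp: algebra_simps)
  moreover have "cosh t - sinh t = exp (- t)" by (simp add: cosh_minus_sinh)
  ultimately have "slope_half t \<ge> 1 - exp (- t)"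
    using t unfolding slope_half_def by linarith
  moreover have "exp (- t) < 1" using t by simp
  ultimately show ?thesis unfolding t_def by linarith
qed

context
begin

private abbreviation (input) Ic :: "real \<Rightarrow> real" where
  "Ic t \<equiv> integral {0..t} (\<lambda>x. x * ln x * cosh x)"
private abbreviation (input) Is :: "real \<Rightarrow> real" where
  "Is t \<equiv> integral {0..t} (\<lambda>x. x * ln x * sinh x)"

private lemma integrable_x_ln_x:
  "(\<lambda>x. x * ln x * cosh x) integrable_on {0..t}" "(\<lambda>x. x * ln x * sinh x) integrable_on {0..t::real}"
  by (intro integrable_continuous_interval continuous_intros continuous_on_subset[OF continuous_on_x_ln_x]; auto)+

private lemma integral_x_ln_x_sinh:
  "integral {0..t} (\<lambda>x. x * ln x * sinh (a - x)) = sinh a * Ic t - cosh a * Is t"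
proof -
  have "(\<lambda>x. x * ln x * sinh (a - x)) = (\<lambda>x. sinh a * (x * ln x * cosh x) - cosh a * (x * ln x * sinh x))"
    by (auto simp: sinh_diff algebra_simps)
  then show ?thesis by (simp add: integral_diff integrable_x_ln_x integrable_on_mult_right)
qed

private lemma deriv_Ic: "0 < t \<Longrightarrow> (Ic has_real_derivative t * ln t * cosh t) (at t)"
  by (rule has_real_derivative_integral[where g = "\<lambda>x. x * ln x * cosh x"], intro continuous_intros continuous_on_x_ln_x, simp)

private lemma deriv_Is: "0 < t \<Longrightarrow> (Is has_real_derivative t * ln t * sinh t) (at t)"
  by (rule has_real_derivative_integral[where g = "\<lambda>x. x * ln x * sinh x"], intro continuous_intros continuous_on_x_ln_x, simp)

lemma slope_half_has_real_derivative:
  assumes "0 < t"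
  shows "(slope_half has_real_derivative 1 + ln t + cosh t * Ic t - sinh t * Is t) (at t)"
proof -
  have "((\<lambda>t. t * ln t + (sinh t * Ic t - cosh t * Is t)) has_real_derivative
      1 + ln t + cosh t * Ic t - sinh t * Is t) (at t)"
    by (rule derivative_eq_intros deriv_Ic deriv_Is assms refl)+ (use assms in \<open>simp add: algebra_simps\<close>)
  then show ?thesis
    by (simp add: slope_half_def[abs_def] integral_x_ln_x_sinh)
qed

text \<open>The numerator of the derivative of \<open>D(t) / sinh (t - 1)\<close>. The addition theorem separates the dependence on \<open>t\<close>
  in \<open>sinh (t - x)\<close>, so that this numerator is \<open>\<phi>'(t) sinh (t - 1) - \<phi>(t) cosh (t - 1) + \<integral>\<^sub>0\<^sup>t \<phi>(x) sinh (x - 1) dx\<close> with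
  \<open>\<phi>(x) = x ln x\<close>. Its derivative collapses to \<open>\<phi>''(t) sinh (t - 1)\<close>.\<close>

private abbreviation (input) K :: "real \<Rightarrow> real" where
  "K t \<equiv> (1 + ln t) * sinh (t - 1) - t * ln t * cosh (t - 1) - sinh 1 * Ic t + cosh 1 * Is t"

text \<open>At \<open>t = 1\<close> only the integral remains, and both \<open>x ln x\<close> and \<open>sinh (x - 1)\<close> are nonpositive on
  \<open>[0, 1]\<close>.\<close>

private lemma K_1: "0 \<le> K 1"
proof -
  have "0 \<le> integral {0..1} (\<lambda>x::real. - (x * ln x * sinh (1 - x)))"
  proof (rule integral_nonneg)
    show "0 \<le> - (x * ln x * sinh (1 - x))" if "x \<in> {0..1}" for x :: real
      using that by (cases "x = 0") (auto simp: mult_nonneg_nonpos mult_nonpos_nonneg)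
  qed (intro integrable_continuous_interval continuous_intros continuous_on_subset[OF continuous_on_x_ln_x]; auto)
  then show ?thesis by (simp add: integral_x_ln_x_sinh)
qed

private lemma deriv_K:
  assumes "0 < t"
  shows "(K has_real_derivative sinh (t - 1) / t) (at t)"
proof -
  have *: "sinh (t - 1) = sinh t * cosh 1 - cosh t * sinh 1" by (simp add: sinh_diff)
  show ?thesis
    by (rule derivative_eq_intros deriv_Ic deriv_Is assms refl)+
       (use assms in \<open>simp_all add: field_simps *\<close>)
qed

private lemma K_pos:
  assumes "1 < t"
  shows "0 < K t"
proof -
  have "K 1 < K t"
  proof (rule DERIV_pos_imp_increasing_open[OF assms])
    show "\<exists>y. (K has_real_derivative y) (at x) \<and> 0 < y" if "1 < x" "x < t" for x
      using deriv_K[of x] that by (intro exI[of _ "sinh (x - 1) / x"]) auto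
    show "continuous_on {1..t} K"
      by (rule DERIV_continuous_on, rule has_field_derivative_at_within, rule deriv_K) auto
  qed
  with K_1 show ?thesis by linarith
qed

text \<open>Why divide by \<open>sinh (t - 1)\<close>: for fixed \<open>x\<close>, the quotient \<open>sinh (t - x) / sinh (t - 1)\<close> increases in \<open>t\<close> if
  \<open>x > 1\<close> and decreases if \<open>x < 1\<close>, so that its product with \<open>x ln x\<close> increases in
  either case. Hence the integral part of the quotient increases, and the positivity of
  \<open>K\<close> shows that adding \<open>t ln t / sinh (t - 1)\<close> preserves this.\<close>

lemma slope_half_quotient_strict_mono:
  assumes "1 < s" "s < t"
  shows "slope_half s / sinh (s - 1) < slope_half t / sinh (t - 1)"
proof (rule DERIV_pos_imp_increasing[OF \<open>s < t\<close>])
  fix x assume x: "s \<le> x" "x \<le> t"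
  then have "1 < x" using assms by simp
  have id: "slope_half x = x * ln x + (sinh x * Ic x - cosh x * Is x)"
    by (simp add: slope_half_def integral_x_ln_x_sinh)
  have hyp: "sinh (x - 1) = sinh x * cosh 1 - cosh x * sinh 1"
    "cosh (x - 1) = cosh x * cosh 1 - sinh x * sinh 1" by (simp_all add: sinh_diff cosh_diff)
  have "(cosh x)\<^sup>2 = 1 + (sinh x)\<^sup>2" using cosh_square_eq[of x] by simp
  then have "(1 + ln x + cosh x * Ic x - sinh x * Is x) * sinh (x - 1) - slope_half x * cosh (x - 1) = K x"
    unfolding id hyp by algebra
  moreover have "((\<lambda>x. slope_half x / sinh (x - 1)) has_real_derivative
     ((1 + ln x + cosh x * Ic x - sinh x * Is x) * sinh (x - 1) - slope_half x * cosh (x - 1)) / (sinh (x - 1))\<^sup>2) (at x)"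
    using \<open>1 < x\<close>
    by (auto intro!: derivative_eq_intros slope_half_has_real_derivative simp: power2_eq_square)
  ultimately show "\<exists>y. ((\<lambda>x. slope_half x / sinh (x - 1)) has_real_derivative y) (at x) \<and> 0 < y"
    using K_pos[OF \<open>1 < x\<close>] \<open>1 < x\<close> by (intro exI[of _ "K x / (sinh (x - 1))\<^sup>2"]) simp
qed

end

lemma slope_half_sign:
  obtains \<tau> where "1 < \<tau>" "slope_half \<tau> = 0"
    "\<And>t. 0 < t \<Longrightarrow> t < \<tau> \<Longrightarrow> slope_half t < 0" "\<And>t. \<tau> < t \<Longrightarrow> 0 < slope_half t"
proof -
  have "\<exists>\<tau>\<ge>1. \<tau> \<le> exp 1 \<and> slope_half \<tau> = 0"
  proof (rule IVT')
    show "continuous_on {1..exp 1} slope_half"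
      by (rule DERIV_continuous_on, rule has_field_derivative_at_within, rule slope_half_has_real_derivative) auto
  qed (use slope_half_neg[of 1] slope_half_exp_1_pos in auto)
  then obtain \<tau> where \<tau>: "1 \<le> \<tau>" "slope_half \<tau> = 0" by blast
  with slope_half_neg[of 1] have "\<tau> \<noteq> 1" by auto
  with \<tau> have "1 < \<tau>" by simp
  show thesis
  proof
    show "slope_half t < 0" if "0 < t" "t < \<tau>" for t
    proof (cases "t \<le> 1")
      case False
      then show ?thesis
        using slope_half_quotient_strict_mono[of t \<tau>] \<tau> that
        by (simp add: divide_less_0_iff)
    qed (use that slope_half_neg in auto)
    show "0 < slope_half t" if "\<tau> < t" for t
      using slope_half_quotient_strict_mono[of \<tau> t] \<tau> that \<open>1 < \<tau>\<close>
      by (simp add: zero_less_divide_iff)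
  qed fact+
qed

section \<open>The second moment as a function of the exponent\<close>

abbreviation sinh_law :: "real \<Rightarrow> real measure" where
  "sinh_law t \<equiv> weighted_law (\<lambda>x. sinh (t - x)) t"

context
  fixes t :: real
  assumes t: "0 < t"
begin

lemma sinh_weight:
  "(\<lambda>x. sinh (t - x)) \<in> borel_measurable borel" "continuous_on {0..t} (\<lambda>x. sinh (t - x))"
  "\<And>x. x \<in> {0..t} \<Longrightarrow> 0 \<le> sinh (t - x)"
  by (auto intro!: continuous_intros borel_measurable_continuous_onI)

interpretation S: finite_bounded_law "sinh_law t" t
  by (rule finite_bounded_weighted_law[OF sinh_weight])

lemma integral_sinh_law_powr:
  assumes "0 < p"
  shows "t powr p + (\<integral>x. x powr p \<partial>sinh_law t) = riemann_sinh_moment t p"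
proof -
  have "(\<integral>x. x powr p \<partial>sinh_law t) = integral {0..t} (\<lambda>x. sinh (t - x) * x powr p)"
    using assms by (intro integral_weighted_law sinh_weight continuous_intros continuous_on_powr') auto
  then show ?thesis by (simp add: riemann_sinh_moment_def mult.commute)
qed

text \<open>In the logic \<open>0 powr 0 = 0\<close>, but the point \<open>0\<close> is negligible.\<close>

lemma integral_sinh_law_powr_0: "1 + (\<integral>x. x powr 0 \<partial>sinh_law t) = cosh t"
proof -
  have "(\<integral>x. x powr 0 \<partial>sinh_law t) = (\<integral>x. 1 \<partial>sinh_law t)"
    by (rule integral_cong_AE) (use S.AE_support in \<open>auto elim!: eventually_mono\<close>)
  also have "\<dots> = integral {0..t} (\<lambda>x. sinh (t - x) * 1)"
    by (intro integral_weighted_law sinh_weight continuous_intros) auto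
  also have "\<dots> = - cosh (t - t) - - cosh (t - 0)"
    using t by (intro integral_FTC_real) (auto intro!: continuous_intros derivative_eq_intros)
  finally show ?thesis by simp
qed

lemma riemann_sinh_moment_1: "riemann_sinh_moment t 1 = sinh t"
proof -
  have "integral {0..t} (\<lambda>x. x powr 1 * sinh (t - x)) = integral {0..t} (\<lambda>x. x * sinh (t - x))"
    by (intro integral_cong) simp
  also have "\<dots> = (- t * cosh (t - t) - sinh (t - t)) - (- 0 * cosh (t - 0) - sinh (t - 0))"
    using t by (intro integral_FTC_real) (auto intro!: continuous_intros derivative_eq_intros)
  finally show ?thesis using t by (simp add: riemann_sinh_moment_def)
qed

lemma slope_half_eq: "t powr 1 * ln t + (\<integral>x. x powr 1 * ln x \<partial>sinh_law t) = slope_half t"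
proof -
  have "(\<integral>x. x powr 1 * ln x \<partial>sinh_law t) = (\<integral>x. x * ln x \<partial>sinh_law t)"
    by (rule integral_cong_AE) (use S.AE_support in \<open>auto elim!: eventually_mono\<close>)
  also have "\<dots> = integral {0..t} (\<lambda>x. sinh (t - x) * (x * ln x))"
    by (intro integral_weighted_law sinh_weight continuous_intros continuous_on_subset[OF continuous_on_x_ln_x]) auto
  finally show ?thesis
    using t by (simp add: slope_half_def mult.commute)
qed

lemma emeasure_sinh_law_neq_0: "emeasure (sinh_law t) (space (sinh_law t)) \<noteq> 0"
proof
  assume "emeasure (sinh_law t) (space (sinh_law t)) = 0"
  then have "AE x in sinh_law t. x powr 0 = (0 :: real)"
    by (intro AE_I[of _ _ "space (sinh_law t)"]) (auto simp: weighted_law_def)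
  then have "(\<integral>x. x powr 0 \<partial>sinh_law t) = (0 :: real)"
    by (rule integral_eq_zero_AE)
  with integral_sinh_law_powr_0 have "cosh t = 1" by simp
  with t cosh_square_eq[of t] show False by simp
qed

lemma AE_sinh_law_neq_1: "AE x in sinh_law t. x \<noteq> 1"
proof -
  note [measurable] = sinh_weight(1)
  have "(\<lambda>x. ennreal (indicator {0<..t} x * sinh (t - x))) \<in> borel_measurable lborel" by measurable
  then show ?thesis
    unfolding weighted_law_def using AE_lborel_singleton[of "1::real"]
    by (subst AE_density) (auto elim!: eventually_mono)
qed

text \<open>The moments of \<open>\<mu>\<^sub>t\<close>, this time with a Lebesgue integral, so that the exponent \<open>0\<close> is included and
  the general results on moments apply.\<close>

definition sinh_moment :: "real \<Rightarrow> real" where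
  "sinh_moment p = t powr p + (\<integral>x. x powr p \<partial>sinh_law t)"

definition sinh_log_moment :: "real \<Rightarrow> real" where
  "sinh_log_moment p = t powr p * ln t + (\<integral>x. x powr p * ln x \<partial>sinh_law t)"

lemma continuous_on_sinh_moment: "continuous_on {0..b} sinh_moment"
  unfolding sinh_moment_def[abs_def] using t by (intro continuous_intros S.continuous_on_moment) auto

lemma has_real_derivative_sinh_moment: "0 < p \<Longrightarrow> (sinh_moment has_real_derivative sinh_log_moment p) (at p)"
  unfolding sinh_moment_def[abs_def] sinh_log_moment_def using t
  by (auto intro!: derivative_eq_intros S.has_real_derivative_moment)

lemma sinh_log_moment_strict_mono:
  assumes "0 < p" "p < q"
  shows "sinh_log_moment p < sinh_log_moment q"
proof -
  have "t powr p * ln t \<le> t powr q * ln t"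
  proof (cases "1 \<le> t")
    case True
    with assms show ?thesis by (intro mult_right_mono powr_mono) auto
  next
    case False
    with assms t show ?thesis by (intro mult_right_mono_neg powr_mono') auto
  qed
  moreover have "(\<integral>x. x powr p * ln x \<partial>sinh_law t) < (\<integral>x. x powr q * ln x \<partial>sinh_law t)"
    by (rule S.log_moment_strict_mono[OF assms AE_sinh_law_neq_1 emeasure_sinh_law_neq_0])
  ultimately show ?thesis by (simp add: sinh_log_moment_def)
qed

lemma sinh_moment_0: "sinh_moment 0 = cosh t"
  and sinh_moment_1: "sinh_moment 1 = sinh t"
  and sinh_log_moment_1: "sinh_log_moment 1 = slope_half t"
  using integral_sinh_law_powr_0 integral_sinh_law_powr[of 1] riemann_sinh_moment_1 slope_half_eq t
  by (simp_all add: sinh_moment_def sinh_log_moment_def)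

end

section \<open>Shape of strictly convex functions and conclusion\<close>

lemma strict_antimono_on_if_deriv_neg:
  fixes f :: "real \<Rightarrow> real"
  assumes "continuous_on {a..b} f"
    and "\<And>x. a < x \<Longrightarrow> x < b \<Longrightarrow> \<exists>y. (f has_real_derivative y) (at x) \<and> y < 0"
  shows "strict_antimono_on {a..b} f"
proof (rule monotone_onI)
  fix x y assume "x \<in> {a..b}" "y \<in> {a..b}" "x < y"
  with assms(2) show "f y < f x"
    by (intro DERIV_neg_imp_decreasing_open[OF \<open>x < y\<close>, of f] continuous_on_subset[OF assms(1)]) auto
qed

lemma strict_mono_on_if_deriv_pos:
  fixes f :: "real \<Rightarrow> real"
  assumes "continuous_on {a..b} f"
    and "\<And>x. a < x \<Longrightarrow> x < b \<Longrightarrow> \<exists>y. (f has_real_derivative y) (at x) \<and> 0 < y"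
  shows "strict_mono_on {a..b} f"
proof (rule monotone_onI)
  fix x y assume "x \<in> {a..b}" "y \<in> {a..b}" "x < y"
  with assms(2) show "f x < f y"
    by (intro DERIV_pos_imp_increasing_open[OF \<open>x < y\<close>, of f] continuous_on_subset[OF assms(1)]) auto
qed

text \<open>Strict convexity is used in the form of a strictly increasing derivative, required only away from the left end point,
  where the moments need not be differentiable. If the slope at \<open>b\<close> is positive, then the minimum is attained
  neither at \<open>b\<close> nor, by \<open>f b < f a\<close>, at \<open>a\<close>. Two different turning points \<open>h1 < h2\<close>
  would make \<open>f\<close> both increase and decrease on \<open>(h1, h2]\<close>.\<close>

lemma strictly_convex_monotonicity:
  fixes f f' :: "real \<Rightarrow> real"
  assumes ab: "a < b" and cont: "continuous_on {a..b} f"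
    and deriv: "\<And>x. a < x \<Longrightarrow> x \<le> b \<Longrightarrow> (f has_real_derivative f' x) (at x)"
    and mono: "strict_mono_on {a<..b} f'"
    and fab: "f b < f a"
  shows "f' b \<le> 0 \<Longrightarrow> strict_antimono_on {a..b} f"
    and "0 < f' b \<Longrightarrow> \<exists>!h. h \<in> {a<..<b} \<and> strict_antimono_on {a..h} f \<and> strict_mono_on {h<..b} f"
proof -
  assume f'b: "f' b \<le> 0"
  show "strict_antimono_on {a..b} f"
  proof (rule strict_antimono_on_if_deriv_neg[OF cont])
    fix x assume x: "a < x" "x < b"
    then have "f' x < f' b" by (intro monotone_onD[OF mono]) auto
    with f'b x show "\<exists>y. (f has_real_derivative y) (at x) \<and> y < 0"
      by (intro exI[of _ "f' x"] conjI deriv) auto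
  qed
next
  assume f'b: "0 < f' b"
  obtain h where h: "h \<in> {a..b}" "\<And>y. y \<in> {a..b} \<Longrightarrow> f h \<le> f y"
    using continuous_attains_inf[OF compact_Icc _ cont] ab by auto
  have "h \<noteq> a" using h(2)[of b] fab ab by auto
  moreover have "h \<noteq> b"
  proof
    assume "h = b"
    obtain d where d: "d > 0" "\<forall>k>0. k < d \<longrightarrow> f (b - k) < f b"
      using DERIV_pos_inc_left[OF deriv f'b] ab by auto
    define k where "k = min (d / 2) (b - a)"
    have "0 < k" "k < d" "b - k \<in> {a..b}" using d ab by (auto simp: k_def min_def)
    with d h(2)[of "b - k"] \<open>h = b\<close> show False by auto
  qed
  ultimately have hab: "a < h" "h < b" using h by auto
  have "f' h = 0"
  proof (rule DERIV_local_min)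
    show "(f has_real_derivative f' h) (at h)" using hab by (intro deriv) auto
    show "0 < min (h - a) (b - h)" using hab by simp
    show "\<forall>y. \<bar>h - y\<bar> < min (h - a) (b - h) \<longrightarrow> f h \<le> f y" by (intro allI impI h) auto
  qed
  have decreasing: "strict_antimono_on {a..h} f"
  proof (rule strict_antimono_on_if_deriv_neg)
    show "continuous_on {a..h} f" using hab by (intro continuous_on_subset[OF cont]) auto
    fix x assume x: "a < x" "x < h"
    then have "f' x < f' h" using hab by (intro monotone_onD[OF mono]) auto
    with x hab \<open>f' h = 0\<close> show "\<exists>y. (f has_real_derivative y) (at x) \<and> y < 0"
      by (intro exI[of _ "f' x"] conjI deriv) auto
  qed
  have "strict_mono_on {h..b} f"
  proof (rule strict_mono_on_if_deriv_pos)
    show "continuous_on {h..b} f" using hab by (intro continuous_on_subset[OF cont]) auto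
    fix x assume x: "h < x" "x < b"
    then have "f' h < f' x" using hab by (intro monotone_onD[OF mono]) auto
    with x hab \<open>f' h = 0\<close> show "\<exists>y. (f has_real_derivative y) (at x) \<and> 0 < y"
      by (intro exI[of _ "f' x"] conjI deriv) auto
  qed
  then have increasing: "strict_mono_on {h<..b} f" by (rule monotone_on_subset) auto
  have "\<not> h1 < h2"
    if "h2 < b" "strict_antimono_on {a..h2} f" "a < h1" "strict_mono_on {h1<..b} f" for h1 h2
  proof
    assume "h1 < h2"
    then obtain x where x: "h1 < x" "x < h2" using dense by blast
    have "f h2 < f x" by (rule monotone_onD[OF that(2)]) (use x that in auto)
    moreover have "f x < f h2" by (rule monotone_onD[OF that(4)]) (use x that in auto)
    ultimately show False by simp
  qed
  note not_less = this
  show "\<exists>!h. h \<in> {a<..<b} \<and> strict_antimono_on {a..h} f \<and> strict_mono_on {h<..b} f"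
  proof (rule ex1I)
    show h_props: "h \<in> {a<..<b} \<and> strict_antimono_on {a..h} f \<and> strict_mono_on {h<..b} f"
      using hab decreasing increasing by simp
    show "k = h" if "k \<in> {a<..<b} \<and> strict_antimono_on {a..k} f \<and> strict_mono_on {k<..b} f" for k
      using not_less[of k h] not_less[of h k] that h_props by auto
  qed
qed

theorem theorem3p7:
  fixes M :: "real \<Rightarrow> 'a measure" and B :: "real \<Rightarrow> real \<Rightarrow> 'a \<Rightarrow> real"
  assumes "\<And>H. 0 < H \<Longrightarrow> H < 1 \<Longrightarrow> fractional_brownian_motion (M H) H (B H)"
  shows "(\<forall>t::real. 0 < t \<and> t \<le> tau_half M B \<longrightarrow>
            strict_antimono_on {0..1/2} (\<lambda>H. V M B H t)) \<and>
         (\<forall>t::real. t > tau_half M B \<longrightarrow>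
            (\<exists>!h::real. h \<in> {0<..<1/2} \<and>
               strict_antimono_on {0..h} (\<lambda>H. V M B H t) \<and>
               strict_mono_on {h<..1/2} (\<lambda>H. V M B H t)))"
proof -
  have V: "V M B H t = exp t * sinh_moment t (2 * H)" if "0 \<le> H" "H < 1" "0 < t" for H t
  proof (cases "H = 0")
    case True
    have "exp (2 * t) = exp t * exp t" by (simp add: exp_add[symmetric])
    then have "exp t * cosh t = (exp (2 * t) + 1) / 2"
      by (simp add: cosh_def exp_minus field_simps)
    with True that show ?thesis by (simp add: V_def sinh_moment_0)
  next
    case False
    with that show ?thesis
      using expectation_exp_integral[OF assms, of H t] integral_sinh_law_powr[of t "2 * H"]
      by (simp add: V_def sinh_moment_def)
  qed
  define V' where "V' t H = 2 * exp t * sinh_log_moment t (2 * H)" for t H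
  have deriv: "((\<lambda>H. V M B H t) has_real_derivative V' t H) (at H)" if "0 < H" "H < 1" "0 < t" for H t
  proof (rule has_field_derivative_transform_within_open)
    have "((\<lambda>H. sinh_moment t (2 * H)) has_real_derivative sinh_log_moment t (2 * H) * 2) (at H)"
      using that by (intro DERIV_chain2[of "sinh_moment t"] has_real_derivative_sinh_moment) (auto intro!: derivative_eq_intros)
    then show "((\<lambda>H. exp t * sinh_moment t (2 * H)) has_real_derivative V' t H) (at H)"
      unfolding V'_def by (auto intro!: derivative_eq_intros)
    show "open {0<..<1::real}" "H \<in> {0<..<1}" using that by auto
    show "exp t * sinh_moment t (2 * K) = V M B K t" if "K \<in> {0<..<1}" for K
      using V[of K t] that \<open>0 < t\<close> by simp
  qed
  have V'_half: "V' t (1 / 2) = 2 * exp t * slope_half t" if "0 < t" for t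
    using that by (simp add: V'_def sinh_log_moment_1)
  obtain \<tau> where \<tau>: "1 < \<tau>" "slope_half \<tau> = 0"
      "\<And>t. 0 < t \<Longrightarrow> t < \<tau> \<Longrightarrow> slope_half t < 0" "\<And>t. \<tau> < t \<Longrightarrow> 0 < slope_half t"
    using slope_half_sign by blast
  have tau: "tau_half M B = \<tau>"
    unfolding tau_half_def
  proof (rule the_equality)
    show "0 < \<tau> \<and> ((\<lambda>H. V M B H \<tau>) has_real_derivative 0) (at (1 / 2))"
      using deriv[of "1/2" \<tau>] \<tau> by (simp add: V'_half)
    fix t assume t: "0 < t \<and> ((\<lambda>H. V M B H t) has_real_derivative 0) (at (1 / 2))"
    then have "V' t (1 / 2) = 0"
      using deriv[of "1/2" t] by (auto intro: DERIV_unique)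
    with t V'_half have "slope_half t = 0" by auto
    with t \<tau>(3,4)[of t] show "t = \<tau>" by (cases t \<tau> rule: linorder_cases) auto
  qed
  have cont: "continuous_on {0..1/2} (\<lambda>H. V M B H t)" if "0 < t" for t
  proof -
    have "continuous_on {0..1/2} (\<lambda>H. exp t * sinh_moment t (2 * H))"
      by (intro continuous_intros continuous_on_compose2[OF continuous_on_sinh_moment[OF that, of 1]]) auto
    moreover have "continuous_on {0..1/2} (\<lambda>H. V M B H t) \<longleftrightarrow> continuous_on {0..1/2} (\<lambda>H. exp t * sinh_moment t (2 * H))"
      by (rule continuous_on_cong) (use V that in auto)
    ultimately show ?thesis by simp
  qed
  have V'_mono: "strict_mono_on {0<..1/2} (V' t)" if "0 < t" for t
    by (rule monotone_onI) (use that sinh_log_moment_strict_mono in \<open>auto simp: V'_def\<close>)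
  have V_less: "V M B (1/2) t < V M B 0 t" if "0 < t" for t
    using V[of "1/2" t] V[of 0 t] that sinh_moment_0[of t] sinh_moment_1[of t] sinh_less_cosh_real[of t] by simp
  note shape = strictly_convex_monotonicity[of 0 "1/2" "\<lambda>H. V M B H t" "V' t" for t,
      OF _ cont deriv V'_mono V_less]
  show ?thesis
  proof (intro conjI allI impI)
    fix t assume t: "0 < t \<and> t \<le> tau_half M B"
    then have "slope_half t \<le> 0" using \<tau>(2) \<tau>(3)[of t] tau by (cases "t = \<tau>") auto
    with t show "strict_antimono_on {0..1/2} (\<lambda>H. V M B H t)"
      by (intro shape(1)) (auto simp: V'_half mult_nonneg_nonpos)
  next
    fix t assume t: "tau_half M B < t"
    with \<tau> tau have "0 < t" "0 < slope_half t" by auto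
    then show "\<exists>!h::real. h \<in> {0<..<1/2} \<and>
        strict_antimono_on {0..h} (\<lambda>H. V M B H t) \<and> strict_mono_on {h<..1/2} (\<lambda>H. V M B H t)"
      by (intro shape(2)) (auto simp: V'_half)
  qed
qed

end
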